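(* Let $\Gamma\curvearrowright(X,\mu)$ be a strongly ergodic p.m.p. action, $H$ be a Polish group and $w:\Gamma\times X\rightarrow H$ a cocycle. Assume that there exists a sequence of Borel maps $\{\phi_n:X\rightarrow H\}_{n\geqslant1}$ such that for all $g\in\Gamma$ we have $$\mu(\{x\in X\mid w(g,x)=\phi_n(gx)\phi_n(x)^{-1}\})\rightarrow1,\quad\text{as }n\rightarrow\infty.$$ Then $w$ is cohomologous to the trivial homomorphism from $\Gamma$ to $H$, i.e. there exists a Borel map $\psi:X\rightarrow H$ such that $w(g,x)=\psi(gx)\psi(x)^{-1}$, for all $g\in\Gamma$ and almost every $x\in X$.
   Context: $\Gamma$ is a countable group and $(X,\mu)$ a standard probability space; p.m.p. means probability measure preserving. A cocycle $w:\Gamma\times X\to H$ is a measurable map with $w(gh,x)=w(g,hx)w(h,x)$ for all $g,h\in\Gamma$ and almost every $x\in X$. An ergodic p.m.p. action is strongly ergodic if for any sequence $\{A_n\}_n$ of Borel subsets of $X$ with $\mu(gA_n\Delta A_n)\to0$ for all $g\in\Gamma$, we have $\mu(A_n)(1-\mu(A_n))\to0$. *)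

theory Defs
  imports "HOL-Probability.Probability" "HOL-Algebra.Group_Action"
begin

definition polish_topology :: "'a topology \<Rightarrow> bool"
  where "polish_topology T \<longleftrightarrow> completely_metrizable_space T \<and> separable_space T"

definition borel_of :: "'a topology \<Rightarrow> 'a measure"
  where "borel_of T = sigma (topspace T) {U. openin T U}"

definition standard_borel_space :: "'a measure \<Rightarrow> bool"
  where "standard_borel_space M \<longleftrightarrow>
    (\<exists>T. polish_topology T \<and> space M = topspace T \<and> sets M = sets (borel_of T))"

text \<open>Atoms are allowed.\<close>

definition standard_prob_space :: "'a measure \<Rightarrow> bool"
  where "standard_prob_space M \<longleftrightarrow> standard_borel_space M \<and> prob_space M"

definition polish_group :: "('h, 'c) monoid_scheme \<Rightarrow> 'h topology \<Rightarrow> bool"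
  where "polish_group H T \<longleftrightarrow>
    group H \<and> topspace T = carrier H \<and> polish_topology T \<and>
    continuous_map (prod_topology T T) T (\<lambda>(x, y). x \<otimes>\<^bsub>H\<^esub> y) \<and>
    continuous_map T T (\<lambda>x. inv\<^bsub>H\<^esub> x)"

text \<open>An action of \<open>G\<close> on the underlying set of \<open>M\<close> is a map \<open>\<phi>\<close> with \<open>\<phi> g x\<close> in the role of
  \<open>g x\<close>.  The library predicate \<open>group_action\<close> makes each \<open>\<phi> g\<close> extensional, that is,
  \<open>undefined\<close> outside \<open>space M\<close>.\<close>

definition pmp_action ::
    "('g, 'c) monoid_scheme \<Rightarrow> 'x measure \<Rightarrow> ('g \<Rightarrow> 'x \<Rightarrow> 'x) \<Rightarrow> bool"
  where "pmp_action G M \<phi> \<longleftrightarrow>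
    group_action G (space M) \<phi> \<and>
    (\<forall>g\<in>carrier G. \<phi> g \<in> M \<rightarrow>\<^sub>M M \<and>
      (\<forall>A\<in>sets M. emeasure M (\<phi> g -` A \<inter> space M) = emeasure M A))"

definition ergodic_action ::
    "('g, 'c) monoid_scheme \<Rightarrow> 'x measure \<Rightarrow> ('g \<Rightarrow> 'x \<Rightarrow> 'x) \<Rightarrow> bool"
  where "ergodic_action G M \<phi> \<longleftrightarrow>
    pmp_action G M \<phi> \<and>
    (\<forall>A\<in>sets M. (\<forall>g\<in>carrier G. \<phi> g ` A = A) \<longrightarrow> measure M A = 0 \<or> measure M A = 1)"

definition strongly_ergodic_action ::
    "('g, 'c) monoid_scheme \<Rightarrow> 'x measure \<Rightarrow> ('g \<Rightarrow> 'x \<Rightarrow> 'x) \<Rightarrow> bool"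
  where "strongly_ergodic_action G M \<phi> \<longleftrightarrow>
    ergodic_action G M \<phi> \<and>
    (\<forall>A. (\<forall>n::nat. A n \<in> sets M) \<and>
         (\<forall>g\<in>carrier G. (\<lambda>n. measure M (sym_diff (\<phi> g ` A n) (A n))) \<longlonglongrightarrow> 0) \<longrightarrow>
         (\<lambda>n. measure M (A n) * (1 - measure M (A n))) \<longlonglongrightarrow> 0)"

text \<open>The acting group is countable and carries the discrete \<open>\<sigma>\<close>-algebra.\<close>

definition cocycle ::
    "('g, 'c) monoid_scheme \<Rightarrow> 'x measure \<Rightarrow> ('g \<Rightarrow> 'x \<Rightarrow> 'x) \<Rightarrow>
     ('h, 'd) monoid_scheme \<Rightarrow> 'h topology \<Rightarrow> ('g \<times> 'x \<Rightarrow> 'h) \<Rightarrow> bool"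
  where "cocycle G M \<phi> H T w \<longleftrightarrow>
    w \<in> count_space (carrier G) \<Otimes>\<^sub>M M \<rightarrow>\<^sub>M borel_of T \<and>
    (\<forall>g\<in>carrier G. \<forall>h\<in>carrier G.
      AE x in M. w (g \<otimes>\<^bsub>G\<^esub> h, x) = w (g, \<phi> h x) \<otimes>\<^bsub>H\<^esub> w (h, x))"

end

theory Submission
  imports Defs
begin

text \<open>For large \<open>m, n\<close> the map \<open>x \<mapsto> \<phi>\<^sub>m(x)\<inverse> \<phi>\<^sub>n(x)\<close> is almost \<open>\<Gamma>\<close>-invariant, since \<open>\<phi>\<^sub>m\<close> and \<open>\<phi>\<^sub>n\<close>
  have the same coboundary on a large set.  Strong ergodicity makes the measure of the preimage of
  every Borel set close to \<open>0\<close> or \<open>1\<close>, uniformly in the set, so a countable family of sets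
  separating the points of \<open>H\<close> pins down a constant that the map takes on a large set.  Along a fast
  subsequence, right multiplication by constants, which does not change coboundaries, makes
  consecutive maps agree outside sets of summable measure; by Borel--Cantelli the corrected maps are
  eventually constant almost everywhere, and their pointwise limit trivialises \<open>w\<close>.\<close>

section \<open>Borel maps into second countable spaces: pairs, equality sets and eventual
  limits\<close>

text \<open>Balls of radius \<open>1 / real (Suc n)\<close> about the points of a countable dense
  set form a countable base. Such a base serves twice below: to handle open sets of a product, and
  to separate points by countably many Borel sets.\<close>

lemma second_countable_polish_topology:
  assumes "polish_topology T"
  shows "second_countable T"
proof -
  obtain S d where S: "Metric_space S d" and T: "T = Metric_space.mtopology S d"
    using assms completely_metrizable_imp_metrizable_space
    unfolding polish_topology_def metrizable_space_def by blast
  interpret Metric_space S d by (fact S)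
  have "separable_space mtopology"
    using assms unfolding polish_topology_def T by (rule conjunct2)
  then obtain C where C: "countable C" "C \<subseteq> S"
      and C': "{x \<in> S. \<forall>r>0. \<exists>y\<in>C. y \<in> mball x r} = S"
    unfolding separable_space_def topspace_mtopology metric_closure_of by (elim exE conjE)
  have dense: "\<exists>c\<in>C. c \<in> mball x r" if "x \<in> S" "r > 0" for x r
    using subsetD[OF equalityD2[OF C'] that(1)] that(2) by simp
  define \<B> where "\<B> = (\<lambda>(c, n). mball c (1 / real (Suc n))) ` (C \<times> UNIV)"
  have "\<exists>V\<in>\<B>. x \<in> V \<and> V \<subseteq> U" if "openin mtopology U" "x \<in> U" for U x
  proof -
    have xS: "x \<in> S"
      using openin_subset[OF that(1)] that(2) by auto
    have "\<exists>r>0. mball x r \<subseteq> U"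
      using that by (simp add: openin_mtopology)
    then obtain r where r: "r > 0" "mball x r \<subseteq> U"
      by (elim exE conjE)
    \<comment> \<open>With radius below \<open>r / 2\<close>, a ball that contains \<open>x\<close>
      stays inside \<open>mball x r\<close>, by the triangle inequality through its centre.\<close>
    obtain n where n: "1 / real (Suc n) < r / 2"
      using nat_approx_posE[of "r / 2"] r(1) by auto
    obtain c where c: "c \<in> C" "c \<in> mball x (1 / real (Suc n))"
      using dense[OF xS, of "1 / real (Suc n)"] by auto
    have "mball c (1 / real (Suc n)) \<subseteq> mball x r"
    proof
      fix y assume y: "y \<in> mball c (1 / real (Suc n))"
      have "d x y \<le> d x c + d c y"
        using triangle[of x c y] c y by simp
      then show "y \<in> mball x r"
        using c(2) y n by simp
    qed
    moreover have "x \<in> mball c (1 / real (Suc n))"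
      using c(2) by (simp add: commute)
    moreover have "mball c (1 / real (Suc n)) \<in> \<B>"
      unfolding \<B>_def using c(1) by (intro image_eqI[of _ _ "(c, n)"]) auto
    ultimately show ?thesis
      using r(2) by (meson order_trans)
  qed
  moreover have "countable \<B>"
    unfolding \<B>_def using C(1) by simp
  moreover have "openin mtopology V" if "V \<in> \<B>" for V
    using that unfolding \<B>_def by auto
  ultimately show ?thesis
    unfolding second_countable_def T by meson
qed

lemma Hausdorff_space_polish_topology: "polish_topology T \<Longrightarrow> Hausdorff_space T"
  unfolding polish_topology_def
  by (simp add: completely_metrizable_imp_metrizable_space metrizable_imp_Hausdorff_space)

lemma space_borel_of [simp]: "space (borel_of T) = topspace T"
  unfolding borel_of_def by (auto simp: space_measure_of_conv)

lemma openin_sets_borel_of: "openin T U \<Longrightarrow> U \<in> sets (borel_of T)"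
  unfolding borel_of_def by (subst sets_measure_of) (auto dest: openin_subset)

lemma measurable_borel_ofI:
  assumes "\<And>x. x \<in> space M \<Longrightarrow> f x \<in> topspace T"
    and "\<And>U. openin T U \<Longrightarrow> f -` U \<inter> space M \<in> sets M"
  shows "f \<in> M \<rightarrow>\<^sub>M borel_of T"
  unfolding borel_of_def using assms
  by (intro measurable_measure_of) (auto dest: openin_subset)

text \<open>By the two countable bases, an open set of the product is a countable union of basic
  open rectangles, and the preimage of a rectangle under the pair is an intersection of two
  measurable sets.\<close>

lemma measurable_Pair_openin_prod:
  assumes f: "f \<in> M \<rightarrow>\<^sub>M borel_of S" and g: "g \<in> M \<rightarrow>\<^sub>M borel_of T"
    and S: "second_countable S" and T: "second_countable T"
    and W: "openin (prod_topology S T) W"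
  shows "{x \<in> space M. (f x, g x) \<in> W} \<in> sets M"
proof -
  obtain \<A> where \<A>: "countable \<A>" "\<And>V. V \<in> \<A> \<Longrightarrow> openin S V"
      "\<And>U x. openin S U \<Longrightarrow> x \<in> U \<Longrightarrow> \<exists>V\<in>\<A>. x \<in> V \<and> V \<subseteq> U"
    using S unfolding second_countable_def by metis
  obtain \<B> where \<B>: "countable \<B>" "\<And>V. V \<in> \<B> \<Longrightarrow> openin T V"
      "\<And>U x. openin T U \<Longrightarrow> x \<in> U \<Longrightarrow> \<exists>V\<in>\<B>. x \<in> V \<and> V \<subseteq> U"
    using T unfolding second_countable_def by metis
  define I where "I = {p \<in> \<A> \<times> \<B>. fst p \<times> snd p \<subseteq> W}"
  have "{x \<in> space M. (f x, g x) \<in> W} =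
      (\<Union>p\<in>I. (f -` fst p \<inter> space M) \<inter> (g -` snd p \<inter> space M))" (is "?L = ?R")
  proof
    show "?L \<subseteq> ?R"
    proof
      fix x assume x: "x \<in> ?L"
      then have "(f x, g x) \<in> W"
        by simp
      then have "\<exists>U V. openin S U \<and> openin T V \<and> f x \<in> U \<and> g x \<in> V \<and> U \<times> V \<subseteq> W"
        using openin_prod_topology_alt[THEN iffD1, OF W] by simp
      then obtain U V where "openin S U" "openin T V" "f x \<in> U" "g x \<in> V" "U \<times> V \<subseteq> W"
        by (elim exE conjE)
      moreover from this obtain A B where "A \<in> \<A>" "f x \<in> A" "A \<subseteq> U" "B \<in> \<B>" "g x \<in> B" "B \<subseteq> V"
        using \<A>(3) \<B>(3) by meson
      ultimately have "(A, B) \<in> I"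
        unfolding I_def by (simp add: Sigma_mono subset_trans[OF Sigma_mono])
      then show "x \<in> ?R"
        using x \<open>f x \<in> A\<close> \<open>g x \<in> B\<close> by (intro UN_I[of "(A, B)"]) simp_all
    qed
  qed (auto simp: I_def)
  moreover have "countable I"
    unfolding I_def using \<A>(1) \<B>(1) by simp
  ultimately show ?thesis
    using \<A>(2) \<B>(2) unfolding I_def
    by (auto intro!: sets.countable_UN' sets.Int measurable_sets[OF f] measurable_sets[OF g]
        openin_sets_borel_of)
qed

lemma measurable_continuous_map_Pair:
  assumes f: "f \<in> M \<rightarrow>\<^sub>M borel_of S" and g: "g \<in> M \<rightarrow>\<^sub>M borel_of T"
    and S: "second_countable S" and T: "second_countable T"
    and h: "continuous_map (prod_topology S T) U (\<lambda>(x, y). h x y)"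
  shows "(\<lambda>x. h (f x) (g x)) \<in> M \<rightarrow>\<^sub>M borel_of U"
proof (rule measurable_borel_ofI)
  have fg: "f x \<in> topspace S" "g x \<in> topspace T" if "x \<in> space M" for x
    using measurable_space[OF f that] measurable_space[OF g that] by auto
  show "h (f x) (g x) \<in> topspace U" if "x \<in> space M" for x
    using continuous_map_image_subset_topspace[OF h] fg[OF that] by force
  show "(\<lambda>x. h (f x) (g x)) -` V \<inter> space M \<in> sets M" if V: "openin U V" for V
  proof -
    have "(\<lambda>x. h (f x) (g x)) -` V \<inter> space M =
      {x \<in> space M. (f x, g x) \<in> {p \<in> topspace (prod_topology S T). (\<lambda>(x, y). h x y) p \<in> V}}"
      using fg by auto
    also have "\<dots> \<in> sets M"
      by (rule measurable_Pair_openin_prod[OF f g S T openin_continuous_map_preimage[OF h V]])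
    finally show ?thesis .
  qed
qed

text \<open>In a Hausdorff space the diagonal is closed, so the points where the two maps differ are
  those that the pair sends into an open set of the product.\<close>

lemma sets_Collect_eq_borel_of:
  assumes f: "f \<in> M \<rightarrow>\<^sub>M borel_of T" and g: "g \<in> M \<rightarrow>\<^sub>M borel_of T"
    and T: "second_countable T" "Hausdorff_space T"
  shows "{x \<in> space M. f x = g x} \<in> sets M"
proof -
  have "closedin (prod_topology T T) ((\<lambda>x. (x, x)) ` topspace T)"
    using T(2) by (simp add: Hausdorff_space_closedin_diagonal)
  then have "openin (prod_topology T T)
      (topspace (prod_topology T T) - (\<lambda>x. (x, x)) ` topspace T)"
    by (simp add: closedin_def)
  from measurable_Pair_openin_prod[OF f g T(1) T(1) this]
  have "space M - {x \<in> space M. (f x, g x) \<in>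
      topspace (prod_topology T T) - (\<lambda>x. (x, x)) ` topspace T} \<in> sets M"
    by (rule sets.compl_sets)
  also have "space M - {x \<in> space M. (f x, g x) \<in>
      topspace (prod_topology T T) - (\<lambda>x. (x, x)) ` topspace T} = {x \<in> space M. f x = g x}"
    using measurable_space[OF f] measurable_space[OF g] by auto
  finally show ?thesis .
qed

text \<open>The limit is \<open>f (K x) x\<close>, where \<open>K x\<close> is the first index from
  which the sequence at \<open>x\<close> is stationary. Since \<open>K\<close> takes countably many
  values, this is a countable gluing of the maps \<open>f k\<close>.\<close>

lemma measurable_eventually_constant_limit:
  fixes f :: "nat \<Rightarrow> 'x \<Rightarrow> 'h"
  assumes f: "\<And>k. f k \<in> M \<rightarrow>\<^sub>M N"
    and eq: "\<And>k. {x \<in> space M. f (Suc k) x = f k x} \<in> sets M"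
    and ev: "AE x in M. \<forall>\<^sub>F k in sequentially. f (Suc k) x = f k x"
  obtains F where "F \<in> M \<rightarrow>\<^sub>M N" "AE x in M. \<forall>\<^sub>F k in sequentially. f k x = F x"
proof -
  have [measurable]: "Measurable.pred M (\<lambda>x. f (Suc k) x = f k x)" for k
    using eq by (simp add: pred_def)
  \<comment> \<open>Where the sequence never settles, \<open>LEAST\<close> is taken over an empty
    predicate. It is then unspecified but the same at all such points, so \<open>K\<close> is
    measurable on the whole space.\<close>
  define K where "K x = (LEAST k. \<forall>j\<ge>k. f (Suc j) x = f j x)" for x
  have K: "K \<in> M \<rightarrow>\<^sub>M count_space UNIV"
    unfolding K_def by measurable
  have "\<forall>\<^sub>F k in sequentially. f k x = f (K x) x"
    if "\<forall>\<^sub>F k in sequentially. f (Suc k) x = f k x" for x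
  proof -
    have "\<exists>k. \<forall>j\<ge>k. f (Suc j) x = f j x"
      using that by (simp add: eventually_sequentially)
    then have *: "\<forall>j\<ge>K x. f (Suc j) x = f j x"
      unfolding K_def by (rule LeastI_ex)
    have "f k x = f (K x) x" if "k \<ge> K x" for k
      using that by (induction k rule: dec_induct) (use * in auto)
    then show ?thesis
      unfolding eventually_sequentially by (intro exI allI impI)
  qed
  then have "AE x in M. \<forall>\<^sub>F k in sequentially. f k x = f (K x) x"
    by (rule AE_mp[OF ev AE_I2, OF impI])
  moreover have "(\<lambda>x. f (K x) x) \<in> M \<rightarrow>\<^sub>M N"
    by (rule measurable_compose_countable[OF f K])
  ultimately show thesis
    by (rule that[rotated])
qed

section \<open>Strong ergodicity and almost invariant maps\<close>

text \<open>From each member of a countable base and its complement, keep the one with the large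
  preimage. The preimage of the intersection of all kept sets is still large, because the dichotomy
  applies again to every finite intersection and stops the errors from adding up. On it
  \<open>f\<close> is constant: a basic set separating two values would have been kept, or its
  complement, and only one of the two values survives.\<close>

lemma prob_zero_one_imp_almost_constant:
  assumes M: "prob_space M" and f: "f \<in> M \<rightarrow>\<^sub>M borel_of T"
    and T: "second_countable T" "Hausdorff_space T"
    and \<epsilon>: "\<epsilon> \<le> 1/3"
    and zero_one: "\<And>B. B \<in> sets (borel_of T) \<Longrightarrow>
      measure M (f -` B \<inter> space M) < \<epsilon> \<or> measure M (f -` B \<inter> space M) > 1 - \<epsilon>"
  obtains c where "c \<in> topspace T" "measure M {x \<in> space M. f x = c} \<ge> 1 - \<epsilon>"
proof -
  interpret prob_space M by (fact M)
  obtain \<B> where \<B>: "countable \<B>" "\<And>V. V \<in> \<B> \<Longrightarrow> openin T V"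
      "\<And>U x. openin T U \<Longrightarrow> x \<in> U \<Longrightarrow> \<exists>V\<in>\<B>. x \<in> V \<and> V \<subseteq> U"
    using T(1) unfolding second_countable_def by metis
  \<comment> \<open>Adding the empty set makes the family nonempty, so that it is the range of a
    sequence.\<close>
  define b where "b = from_nat_into (insert {} \<B>)"
  have b_range: "range b = insert {} \<B>"
    unfolding b_def using \<B>(1) by (intro range_from_nat_into) auto
  have b_open: "openin T (b n)" for n
  proof -
    have "b n \<in> insert {} \<B>" using b_range by blast
    then show ?thesis using \<B>(2) by auto
  qed
  define P where "P B = measure M (f -` B \<inter> space M)" for B
  define C where "C n = (if P (b n) > 1 - \<epsilon> then b n else topspace T - b n)" for n
  have C_sets: "C n \<in> sets (borel_of T)" for n
    using openin_sets_borel_of[OF b_open] sets.compl_sets[of "b n" "borel_of T"]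
    unfolding C_def by simp
  have P_C: "P (C n) > 1 - \<epsilon>" for n
  proof (cases "P (b n) > 1 - \<epsilon>")
    case False
    then have "P (b n) < \<epsilon>"
      using zero_one[OF openin_sets_borel_of[OF b_open]] unfolding P_def by blast
    moreover have "f -` (topspace T - b n) \<inter> space M = space M - (f -` b n \<inter> space M)"
      using measurable_space[OF f] by auto
    ultimately show ?thesis
      using False measurable_sets[OF f openin_sets_borel_of[OF b_open]]
      by (simp add: P_def C_def prob_compl)
  qed (simp add: C_def)
  define D where "D n = (\<Inter>i\<le>n. f -` C i \<inter> space M)" for n
  have D_vimage: "D n = f -` (\<Inter>i\<le>n. C i) \<inter> space M" for n
    unfolding D_def by auto
  have INT_sets: "(\<Inter>i\<le>n. C i) \<in> sets (borel_of T)" for n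
    using C_sets by auto
  have D_sets: "D n \<in> sets M" for n
    unfolding D_vimage by (rule measurable_sets[OF f INT_sets])
  have P_D: "measure M (D n) > 1 - \<epsilon>" for n
  proof (induction n)
    case 0
    show ?case using P_C[of 0] unfolding D_def P_def by simp
  next
    case (Suc n)
    let ?E = "f -` C (Suc n) \<inter> space M"
    have E: "?E \<in> sets M" by (rule measurable_sets[OF f C_sets])
    have D_Suc: "D (Suc n) = D n \<inter> ?E"
      unfolding D_def by (auto simp: atMost_Suc)
    have "measure M (D n \<union> ?E) = measure M (D n) + measure M ?E - measure M (D n \<inter> ?E)"
      using measure_Un3[of "D n" M ?E] D_sets E by (simp add: fmeasurable_eq_sets)
    moreover have "measure M (D n \<union> ?E) \<le> 1" by simp
    ultimately have "measure M (D (Suc n)) > 1 - 2 * \<epsilon>"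
      using Suc P_C[of "Suc n"] unfolding D_Suc P_def by linarith
    \<comment> \<open>Since \<epsilon> is at most \<open>1/3\<close>, the bound
      \<open>1 - 2 * \<epsilon>\<close> is at least \<epsilon>. The small alternative is thus
      excluded, and the dichotomy restores the bound \<open>1 - \<epsilon>\<close>.\<close>
    then show ?case
      using zero_one[OF INT_sets, of "Suc n"] \<epsilon> unfolding D_vimage by linarith
  qed
  have "(\<lambda>n. measure M (D n)) \<longlonglongrightarrow> measure M (\<Inter>n. D n)"
    by (rule finite_Lim_measure_decseq) (use D_sets in \<open>auto simp: D_def decseq_def\<close>)
  then have large: "measure M (\<Inter>n. D n) \<ge> 1 - \<epsilon>"
    by (rule LIMSEQ_le_const) (use P_D in \<open>auto intro: less_imp_le\<close>)
  then have "measure M (\<Inter>n. D n) \<noteq> 0"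
    using \<epsilon> by linarith
  then have "(\<Inter>n. D n) \<noteq> {}"
    by (metis measure_empty)
  then obtain x where x: "x \<in> (\<Inter>n. D n)" by blast
  then have xM: "x \<in> space M" unfolding D_def by auto
  have "f y = f x" if y: "y \<in> (\<Inter>n. D n)" for y
  proof (rule ccontr)
    assume ne: "f y \<noteq> f x"
    have yM: "y \<in> space M" using y unfolding D_def by auto
    have "f x \<in> topspace T" "f y \<in> topspace T"
      using measurable_space[OF f xM] measurable_space[OF f yM] by auto
    then obtain U V where "openin T U" "openin T V" "f x \<in> U" "f y \<in> V" "disjnt U V"
      using T(2) ne unfolding Hausdorff_space_def by metis
    moreover from this obtain B where "B \<in> \<B>" "f x \<in> B" "B \<subseteq> U"
      using \<B>(3) by meson
    moreover from this obtain n where "B = b n"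
      using b_range by (metis insertI2 rangeE)
    moreover have "f x \<in> C n" "f y \<in> C n"
      using x y unfolding D_def by auto
    ultimately show False
      unfolding C_def disjnt_def by (auto split: if_splits)
  qed
  then have "(\<Inter>n. D n) \<subseteq> {y \<in> space M. f y = f x}"
    unfolding D_def by auto
  moreover have "{y \<in> space M. f y = f x} \<in> sets M"
    using sets_Collect_eq_borel_of[OF f measurable_const T, of "f x"] measurable_space[OF f xM]
    by simp
  ultimately have "measure M (\<Inter>n. D n) \<le> measure M {y \<in> space M. f y = f x}"
    by (rule finite_measure_mono)
  then have "measure M {y \<in> space M. f y = f x} \<ge> 1 - \<epsilon>"
    using large by linarith
  moreover have "f x \<in> topspace T"
    using measurable_space[OF f xM] by simp
  ultimately show thesis
    by (rule that[rotated])
qed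

text \<open>This turns the sequential definition into an epsilon-delta form. If no finite set and
  tolerance worked, then for every \<open>k\<close> some set would be invariant up to
  \<open>1 / real (Suc k)\<close> under the first \<open>k + 1\<close> elements of an enumeration
  while its product stays at least \<epsilon>. These sets form a sequence that contradicts strong
  ergodicity.\<close>

lemma strongly_ergodic_action_uniform:
  fixes \<epsilon> :: real
  assumes "strongly_ergodic_action G M act" and "countable (carrier G)" and "carrier G \<noteq> {}"
    and "\<epsilon> > 0"
  obtains F \<delta> where "finite F" "F \<subseteq> carrier G" "\<delta> > 0"
    "\<And>A. A \<in> sets M \<Longrightarrow> (\<And>g. g \<in> F \<Longrightarrow> measure M (sym_diff (act g ` A) A) < \<delta>) \<Longrightarrow>
      measure M A * (1 - measure M A) < \<epsilon>"
proof (rule ccontr)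
  assume "\<not> thesis"
  define e where "e = from_nat_into (carrier G)"
  have e_range: "range e = carrier G"
    unfolding e_def using assms(2,3) by (rule range_from_nat_into[rotated])
  define bad where "bad k A \<longleftrightarrow> A \<in> sets M \<and>
      (\<forall>g\<in>e ` {..k}. measure M (sym_diff (act g ` A) A) < 1 / real (Suc k)) \<and>
      measure M A * (1 - measure M A) \<ge> \<epsilon>" for k A
  have "\<exists>A. bad k A" for k
  proof (rule ccontr)
    assume neg: "\<not> (\<exists>A. bad k A)"
    have thesis
    proof (rule that[of "e ` {..k}" "1 / real (Suc k)"])
      fix A assume A: "A \<in> sets M"
        "\<And>g. g \<in> e ` {..k} \<Longrightarrow> measure M (sym_diff (act g ` A) A) < 1 / real (Suc k)"
      show "measure M A * (1 - measure M A) < \<epsilon>"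
      proof (rule ccontr)
        assume "\<not> ?thesis"
        then have "measure M A * (1 - measure M A) \<ge> \<epsilon>" by simp
        then have "bad k A"
          unfolding bad_def using A(1) by (intro conjI ballI A(2))
        then show False
          using neg by simp
      qed
    qed (use e_range in auto)
    with \<open>\<not> thesis\<close> show False ..
  qed
  then obtain A where bad: "bad k (A k)" for k
    by metis
  note A = bad[unfolded bad_def, THEN conjunct1]
    bad[unfolded bad_def, THEN conjunct2, THEN conjunct1, THEN bspec]
    bad[unfolded bad_def, THEN conjunct2, THEN conjunct2]
  have "(\<lambda>k. measure M (sym_diff (act g ` A k) (A k))) \<longlonglongrightarrow> 0" if "g \<in> carrier G" for g
  proof -
    have "g \<in> range e" using that e_range by simp
    then obtain i where i: "g = e i" by (rule rangeE)
    \<comment> \<open>The element \<open>e i\<close> is among those tested from stage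
      \<open>i\<close> on, so the bound holds only eventually.\<close>
    have "\<forall>\<^sub>F k in sequentially. norm (measure M (sym_diff (act g ` A k) (A k))) \<le> 1 / real (Suc k)"
      using eventually_ge_at_top[of i]
      by eventually_elim (use A(2) i in \<open>auto intro!: less_imp_le\<close>)
    moreover have "(\<lambda>k. 1 / real (Suc k)) \<longlonglongrightarrow> 0"
      using LIMSEQ_inverse_real_of_nat by (simp add: inverse_eq_divide)
    ultimately show ?thesis
      by (rule Lim_null_comparison)
  qed
  then have "(\<lambda>k. measure M (A k) * (1 - measure M (A k))) \<longlonglongrightarrow> 0"
    using assms(1) A(1) unfolding strongly_ergodic_action_def by blast
  then have "0 \<ge> \<epsilon>"
    by (rule LIMSEQ_le_const) (use A(3) in auto)
  then show False using assms(4) by simp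
qed

text \<open>A point of \<open>X\<close> lies in the translate of the preimage exactly when
  \<open>f\<close> sends its image under the inverse of \<open>g\<close> into \<open>B\<close>.
  Hence at a point of the symmetric difference exactly one of the two values of \<open>f\<close> is
  in \<open>B\<close>. The bound does not mention \<open>B\<close>, which is the source of
  uniformity over all Borel sets.\<close>

lemma sym_diff_image_vimage_subset:
  assumes "group_action G X act" and "g \<in> carrier G"
  shows "sym_diff (act g ` (f -` B \<inter> X)) (f -` B \<inter> X)
    \<subseteq> {x \<in> X. f (act (inv\<^bsub>G\<^esub> g) x) \<noteq> f x}"
proof -
  interpret group_action G X act by (fact assms(1))
  interpret group G using group_hom group_hom.axioms(1) by auto
  have left: "act (inv\<^bsub>G\<^esub> g) (act g a) = a" "act g a \<in> X" if "a \<in> X" for a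
    using that assms(2) orbit_sym_aux element_image by auto
  have right: "act g (act (inv\<^bsub>G\<^esub> g) x) = x" "act (inv\<^bsub>G\<^esub> g) x \<in> X" if "x \<in> X" for x
    using that assms(2) orbit_sym_aux[of "inv\<^bsub>G\<^esub> g" x] element_image[of "inv\<^bsub>G\<^esub> g" x] by auto
  show ?thesis
  proof
    fix x assume "x \<in> sym_diff (act g ` (f -` B \<inter> X)) (f -` B \<inter> X)"
    then consider a where "x = act g a" "f a \<in> B" "a \<in> X" "f x \<notin> B \<or> x \<notin> X"
      | "x \<in> X" "f x \<in> B" "x \<notin> act g ` (f -` B \<inter> X)"
      by auto
    then show "x \<in> {x \<in> X. f (act (inv\<^bsub>G\<^esub> g) x) \<noteq> f x}"
    proof cases
      case 1
      then show ?thesis using left by auto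
    next
      case 2
      then have "f (act (inv\<^bsub>G\<^esub> g) x) \<notin> B"
        using right by (metis IntI image_eqI vimageI)
      then show ?thesis using 2 by auto
    qed
  qed
qed

text \<open>The finite set and the tolerance do not depend on \<open>f\<close>: the preimages under \<open>f\<close> of all Borel
  sets are almost invariant at once, with the same error.\<close>

lemma strongly_ergodic_action_almost_invariant_map:
  fixes \<epsilon> :: real
  assumes "strongly_ergodic_action G M act" and "countable (carrier G)" and "prob_space M"
    and T: "second_countable T" "Hausdorff_space T"
    and "\<epsilon> > 0"
  obtains F \<delta> where "finite F" "F \<subseteq> carrier G" "\<delta> > 0"
    "\<And>f. f \<in> M \<rightarrow>\<^sub>M borel_of T \<Longrightarrow>
      (\<And>g. g \<in> F \<Longrightarrow> measure M {x \<in> space M. f (act g x) \<noteq> f x} < \<delta>) \<Longrightarrow>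
      \<exists>c\<in>topspace T. measure M {x \<in> space M. f x = c} \<ge> 1 - \<epsilon>"
proof -
  interpret prob_space M by (fact assms(3))
  have pmp: "pmp_action G M act"
    using assms(1) unfolding strongly_ergodic_action_def ergodic_action_def by blast
  then have act: "group_action G (space M) act"
    unfolding pmp_action_def by blast
  then interpret group_action G "space M" act .
  interpret group G using group_hom group_hom.axioms(1) by auto
  \<comment> \<open>The cap \<open>1/3\<close> is what the passage from the dichotomy to an almost
    constant map requires.\<close>
  define \<epsilon>' where "\<epsilon>' = min \<epsilon> (1/3)"
  have \<epsilon>': "0 < \<epsilon>'" "\<epsilon>' \<le> 1/3" "\<epsilon>' \<le> \<epsilon>"
    using assms(6) unfolding \<epsilon>'_def by auto
  then have "\<epsilon>' * (1 - \<epsilon>') > 0" by simp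
  then obtain F \<delta> where F: "finite F" "F \<subseteq> carrier G" "\<delta> > 0"
    and uniform: "\<And>A. A \<in> sets M \<Longrightarrow>
      (\<And>g. g \<in> F \<Longrightarrow> measure M (sym_diff (act g ` A) A) < \<delta>) \<Longrightarrow>
      measure M A * (1 - measure M A) < \<epsilon>' * (1 - \<epsilon>')"
    using strongly_ergodic_action_uniform[OF assms(1,2)] one_closed by blast
  show thesis
  proof (rule that)
    \<comment> \<open>The symmetric difference for \<open>g\<close> is controlled by comparing
      \<open>f\<close> at \<open>x\<close> with \<open>f\<close> at its image under the inverse of
      \<open>g\<close>, hence the passage to inverses.\<close>
    show "finite (m_inv G ` F)" "m_inv G ` F \<subseteq> carrier G" "\<delta> > 0"
      using F by auto
    fix f assume f: "f \<in> M \<rightarrow>\<^sub>M borel_of T"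
      and inv: "\<And>g. g \<in> m_inv G ` F \<Longrightarrow> measure M {x \<in> space M. f (act g x) \<noteq> f x} < \<delta>"
    have "measure M (f -` B \<inter> space M) < \<epsilon>' \<or> measure M (f -` B \<inter> space M) > 1 - \<epsilon>'"
      if B: "B \<in> sets (borel_of T)" for B
    proof -
      let ?A = "f -` B \<inter> space M" and ?t = "measure M (f -` B \<inter> space M)"
      have "measure M (sym_diff (act g ` ?A) ?A) < \<delta>" if g: "g \<in> F" for g
      proof -
        have g': "g \<in> carrier G" "inv\<^bsub>G\<^esub> g \<in> carrier G" using g F(2) by auto
        then have "act (inv\<^bsub>G\<^esub> g) \<in> M \<rightarrow>\<^sub>M M"
          using pmp unfolding pmp_action_def by blast
        then have "(\<lambda>x. f (act (inv\<^bsub>G\<^esub> g) x)) \<in> M \<rightarrow>\<^sub>M borel_of T"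
          by (rule measurable_compose[OF _ f])
        then have "{x \<in> space M. f (act (inv\<^bsub>G\<^esub> g) x) = f x} \<in> sets M"
          by (rule sets_Collect_eq_borel_of[OF _ f T])
        then have "{x \<in> space M. f (act (inv\<^bsub>G\<^esub> g) x) \<noteq> f x} \<in> sets M"
          by (rule sets.sets_Collect_neg)
        then have "measure M (sym_diff (act g ` ?A) ?A)
            \<le> measure M {x \<in> space M. f (act (inv\<^bsub>G\<^esub> g) x) \<noteq> f x}"
          by (rule finite_measure_mono[OF sym_diff_image_vimage_subset[OF act g'(1)]])
        also have "\<dots> < \<delta>" using inv g by blast
        finally show ?thesis .
      qed
      then have "?t * (1 - ?t) < \<epsilon>' * (1 - \<epsilon>')"
        using uniform[OF measurable_sets[OF f B]] by blast
      \<comment> \<open>This factorisation is the reason for the threshold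
        \<open>\<epsilon>' * (1 - \<epsilon>')\<close>: a negative product has a negative factor,
        and that is the required dichotomy.\<close>
      moreover have "?t * (1 - ?t) - \<epsilon>' * (1 - \<epsilon>') = (?t - \<epsilon>') * (1 - \<epsilon>' - ?t)"
        by (simp add: algebra_simps)
      ultimately have "\<not> (?t - \<epsilon>' \<ge> 0 \<and> 1 - \<epsilon>' - ?t \<ge> 0)"
        using mult_nonneg_nonneg[of "?t - \<epsilon>'" "1 - \<epsilon>' - ?t"] by linarith
      then show ?thesis by linarith
    qed
    then obtain c where "c \<in> topspace T" "measure M {x \<in> space M. f x = c} \<ge> 1 - \<epsilon>'"
      using prob_zero_one_imp_almost_constant[OF assms(3) f T \<epsilon>'(2)] by blast
    then show "\<exists>c\<in>topspace T. measure M {x \<in> space M. f x = c} \<ge> 1 - \<epsilon>"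
      using \<epsilon>'(3) by (intro bexI[of _ c]) auto
  qed
qed

section \<open>Borel maps into Polish groups and their coboundaries\<close>

lemma measurable_continuous_map_compose:
  assumes f: "f \<in> M \<rightarrow>\<^sub>M borel_of S" and h: "continuous_map S T h"
  shows "(\<lambda>x. h (f x)) \<in> M \<rightarrow>\<^sub>M borel_of T"
proof (rule measurable_borel_ofI)
  have fS: "f x \<in> topspace S" if "x \<in> space M" for x
    using measurable_space[OF f that] by simp
  show "h (f x) \<in> topspace T" if "x \<in> space M" for x
    using continuous_map_image_subset_topspace[OF h] fS[OF that] by (rule subsetD[OF _ imageI])
  show "(\<lambda>x. h (f x)) -` U \<inter> space M \<in> sets M" if U: "openin T U" for U
  proof -
    have "(\<lambda>x. h (f x)) -` U \<inter> space M = f -` {y \<in> topspace S. h y \<in> U} \<inter> space M"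
      using fS by auto
    also have "\<dots> \<in> sets M"
      by (intro measurable_sets[OF f] openin_sets_borel_of openin_continuous_map_preimage[OF h U])
    finally show ?thesis .
  qed
qed

lemma polish_groupD:
  assumes "polish_group H T"
  shows "group H" and "topspace T = carrier H" and "second_countable T" and "Hausdorff_space T"
    and "continuous_map (prod_topology T T) T (\<lambda>(x, y). x \<otimes>\<^bsub>H\<^esub> y)"
    and "continuous_map T T (\<lambda>x. inv\<^bsub>H\<^esub> x)"
proof -
  have "polish_topology T"
    using assms unfolding polish_group_def by simp
  then show "second_countable T" "Hausdorff_space T"
    by (rule second_countable_polish_topology, rule Hausdorff_space_polish_topology)
qed (use assms in \<open>simp_all add: polish_group_def\<close>)

lemma polish_group_measurable_mult:
  assumes "polish_group H T" and "f \<in> M \<rightarrow>\<^sub>M borel_of T" and "g \<in> M \<rightarrow>\<^sub>M borel_of T"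
  shows "(\<lambda>x. f x \<otimes>\<^bsub>H\<^esub> g x) \<in> M \<rightarrow>\<^sub>M borel_of T"
  by (rule measurable_continuous_map_Pair[OF assms(2,3) polish_groupD(3,3,5)[OF assms(1)]])

lemma polish_group_measurable_inv:
  assumes "polish_group H T" and "f \<in> M \<rightarrow>\<^sub>M borel_of T"
  shows "(\<lambda>x. inv\<^bsub>H\<^esub> (f x)) \<in> M \<rightarrow>\<^sub>M borel_of T"
  by (rule measurable_continuous_map_compose[OF assms(2) polish_groupD(6)[OF assms(1)]])

lemma sets_Collect_coboundary:
  assumes H: "polish_group H T" and a: "a \<in> M \<rightarrow>\<^sub>M M"
    and u: "u \<in> M \<rightarrow>\<^sub>M borel_of T" and f: "f \<in> M \<rightarrow>\<^sub>M borel_of T"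
  shows "{x \<in> space M. u x = f (a x) \<otimes>\<^bsub>H\<^esub> inv\<^bsub>H\<^esub> (f x)} \<in> sets M"
  by (rule sets_Collect_eq_borel_of[OF u _ polish_groupD(3,4)[OF H]])
    (intro polish_group_measurable_mult[OF H] polish_group_measurable_inv[OF H]
      f measurable_compose[OF a f])

text \<open>Here \<open>a\<close>, \<open>b\<close> will be the values of one map at
  \<open>g x\<close> and \<open>x\<close>, and \<open>c\<close>, \<open>d\<close> those of another.
  Equal coboundaries then make the quotient of the two maps take the same value at
  \<open>g x\<close> and \<open>x\<close>.\<close>

lemma (in group) inv_mult_eq_of_mult_inv_eq:
  assumes "a \<in> carrier G" "b \<in> carrier G" "c \<in> carrier G" "d \<in> carrier G"
    and "a \<otimes> inv b = c \<otimes> inv d"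
  shows "inv a \<otimes> c = inv b \<otimes> d"
proof -
  have "c = (c \<otimes> inv d) \<otimes> d"
    using assms(3,4) by (simp add: m_assoc)
  also have "\<dots> = a \<otimes> (inv b \<otimes> d)"
    using assms by (simp add: m_assoc flip: assms(5))
  finally show ?thesis
    using assms(1-4) inv_solve_left'[of "inv b \<otimes> d" a c] by simp
qed

text \<open>Used with \<open>c\<close> constant in the point: translating a map on the right by a
  constant keeps its coboundary.\<close>

lemma (in group) mult_right_cancel_in_quotient:
  assumes "a \<in> carrier G" "b \<in> carrier G" "c \<in> carrier G"
  shows "(a \<otimes> c) \<otimes> inv (b \<otimes> c) = a \<otimes> inv b"
  using assms by (simp add: inv_mult_group m_assoc inv_solve_left' flip: m_assoc[of c "inv c"])

text \<open>Where \<open>w\<close> is the coboundary of both maps, their quotient does not change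
  under \<open>g\<close>. Strong ergodicity asks for this only for finitely many \<open>g\<close>
  and up to a fixed tolerance \<delta>, so it suffices that each of the two coboundary equations
  fails on measure less than \<open>\<delta> / 2\<close>.\<close>

lemma coboundary_quotients_almost_constant:
  fixes \<epsilon> :: real and \<phi> :: "nat \<Rightarrow> 'x \<Rightarrow> 'h"
  assumes act: "strongly_ergodic_action G M act" and "countable (carrier G)" and "prob_space M"
    and H: "polish_group H T"
    and w: "\<And>g. g \<in> carrier G \<Longrightarrow> (\<lambda>x. w (g, x)) \<in> M \<rightarrow>\<^sub>M borel_of T"
    and \<phi>: "\<And>n. n \<ge> 1 \<Longrightarrow> \<phi> n \<in> M \<rightarrow>\<^sub>M borel_of T"
    and lim: "\<And>g. g \<in> carrier G \<Longrightarrow>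
      (\<lambda>n. measure M {x \<in> space M. w (g, x) = \<phi> n (act g x) \<otimes>\<^bsub>H\<^esub> inv\<^bsub>H\<^esub> (\<phi> n x)}) \<longlonglongrightarrow> 1"
    and \<epsilon>: "\<epsilon> > 0"
  shows "\<exists>N. \<forall>m\<ge>N. \<forall>n\<ge>N. \<exists>c\<in>carrier H.
    measure M {x \<in> space M. inv\<^bsub>H\<^esub> (\<phi> m x) \<otimes>\<^bsub>H\<^esub> \<phi> n x = c} \<ge> 1 - \<epsilon>"
proof -
  interpret prob_space M by (fact assms(3))
  interpret H: group H by (rule polish_groupD(1)[OF H])
  note T = polish_groupD(3,4)[OF H] and HT = polish_groupD(2)[OF H]
  obtain F \<delta> where F: "finite F" "F \<subseteq> carrier G" "\<delta> > 0"
    and const: "\<And>f. f \<in> M \<rightarrow>\<^sub>M borel_of T \<Longrightarrow>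
      (\<And>g. g \<in> F \<Longrightarrow> measure M {x \<in> space M. f (act g x) \<noteq> f x} < \<delta>) \<Longrightarrow>
      \<exists>c\<in>topspace T. measure M {x \<in> space M. f x = c} \<ge> 1 - \<epsilon>"
    using strongly_ergodic_action_almost_invariant_map[OF act assms(2,3) T \<epsilon>] by blast
  define E where "E n g = {x \<in> space M. w (g, x) = \<phi> n (act g x) \<otimes>\<^bsub>H\<^esub> inv\<^bsub>H\<^esub> (\<phi> n x)}" for n g
  have act_M: "act g \<in> M \<rightarrow>\<^sub>M M" if "g \<in> F" for g
    using act F(2) that
    unfolding strongly_ergodic_action_def ergodic_action_def pmp_action_def by (simp add: subsetD)
  have E_sets: "E n g \<in> sets M" if "n \<ge> 1" "g \<in> F" for n g
    unfolding E_def using that F(2)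
    by (intro sets_Collect_coboundary[OF H act_M w \<phi>]) (simp_all add: subsetD)
  have "\<forall>\<^sub>F n in sequentially. \<forall>g\<in>F. measure M (E n g) > 1 - \<delta> / 2"
  \<comment> \<open>Convergence is assumed for each \<open>g\<close> separately; finiteness of
    \<open>F\<close> gives one common index.\<close>
  proof (rule eventually_ball_finite[OF F(1)], rule ballI)
    fix g assume "g \<in> F"
    then have "(\<lambda>n. measure M (E n g)) \<longlonglongrightarrow> 1"
      unfolding E_def using F(2) by (intro lim) (rule subsetD)
    then show "\<forall>\<^sub>F n in sequentially. measure M (E n g) > 1 - \<delta> / 2"
      by (rule order_tendstoD) (use F(3) in simp)
  qed
  then obtain N where N: "measure M (E n g) > 1 - \<delta> / 2" if "n \<ge> N" "g \<in> F" for n g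
    unfolding eventually_sequentially by metis
  \<comment> \<open>Starting at \<open>Suc N\<close> keeps the indices at least 1, where the maps
    are known to be Borel.\<close>
  have "\<exists>c\<in>carrier H. measure M {x \<in> space M. inv\<^bsub>H\<^esub> (\<phi> m x) \<otimes>\<^bsub>H\<^esub> \<phi> n x = c} \<ge> 1 - \<epsilon>"
    if mn: "m \<ge> Suc N" "n \<ge> Suc N" for m n
    unfolding HT[symmetric]
  proof (rule const)
    have \<phi>m: "\<phi> m \<in> M \<rightarrow>\<^sub>M borel_of T" and \<phi>n: "\<phi> n \<in> M \<rightarrow>\<^sub>M borel_of T"
      using mn by (simp_all add: \<phi>)
    show "(\<lambda>x. inv\<^bsub>H\<^esub> (\<phi> m x) \<otimes>\<^bsub>H\<^esub> \<phi> n x) \<in> M \<rightarrow>\<^sub>M borel_of T"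
      by (intro polish_group_measurable_mult[OF H] polish_group_measurable_inv[OF H] \<phi>m \<phi>n)
    fix g assume g: "g \<in> F"
    have Em: "E m g \<in> sets M" and En: "E n g \<in> sets M"
      using mn g by (simp_all add: E_sets)
    let ?D = "{x \<in> space M. inv\<^bsub>H\<^esub> (\<phi> m (act g x)) \<otimes>\<^bsub>H\<^esub> \<phi> n (act g x) \<noteq>
        inv\<^bsub>H\<^esub> (\<phi> m x) \<otimes>\<^bsub>H\<^esub> \<phi> n x}"
    have "?D \<subseteq> (space M - E m g) \<union> (space M - E n g)"
    proof
      fix x assume x: "x \<in> ?D"
      then have xM: "x \<in> space M" by simp
      have gx: "act g x \<in> space M"
        by (rule measurable_space[OF act_M[OF g] xM])
      have car: "\<phi> m (act g x) \<in> carrier H" "\<phi> m x \<in> carrier H"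
          "\<phi> n (act g x) \<in> carrier H" "\<phi> n x \<in> carrier H"
        using measurable_space[OF \<phi>m gx] measurable_space[OF \<phi>m xM]
          measurable_space[OF \<phi>n gx] measurable_space[OF \<phi>n xM] HT by simp_all
      have "\<not> (x \<in> E m g \<and> x \<in> E n g)"
      proof
        assume *: "x \<in> E m g \<and> x \<in> E n g"
        have "w (g, x) = \<phi> m (act g x) \<otimes>\<^bsub>H\<^esub> inv\<^bsub>H\<^esub> (\<phi> m x)"
          using conjunct1[OF *] unfolding E_def by simp
        moreover have "w (g, x) = \<phi> n (act g x) \<otimes>\<^bsub>H\<^esub> inv\<^bsub>H\<^esub> (\<phi> n x)"
          using conjunct2[OF *] unfolding E_def by simp
        ultimately have "\<phi> m (act g x) \<otimes>\<^bsub>H\<^esub> inv\<^bsub>H\<^esub> (\<phi> m x) = \<phi> n (act g x) \<otimes>\<^bsub>H\<^esub> inv\<^bsub>H\<^esub> (\<phi> n x)"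
          by (rule trans[OF sym])
        from H.inv_mult_eq_of_mult_inv_eq[OF car this] x show False by simp
      qed
      then show "x \<in> (space M - E m g) \<union> (space M - E n g)"
        using xM by simp
    qed
    then have "measure M ?D \<le> measure M ((space M - E m g) \<union> (space M - E n g))"
      by (rule finite_measure_mono) (intro sets.Un sets.compl_sets Em En)
    also have "\<dots> \<le> measure M (space M - E m g) + measure M (space M - E n g)"
      by (rule measure_Un_le) (intro sets.compl_sets Em En)+
    also have "\<dots> = (1 - measure M (E m g)) + (1 - measure M (E n g))"
      using Em En by (simp add: prob_compl)
    also have "\<dots> < \<delta>"
      using N[of m g] N[of n g] mn g by simp
    finally show "measure M ?D < \<delta>" .
  qed
  then show ?thesis
    by (intro exI[of _ "Suc N"] allI impI)
qed

section \<open>Construction of the trivialising map\<close>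

text \<open>The set \<open>B k\<close> of points missing every \<open>E n\<close> with
  \<open>n\<close> at least \<open>k\<close> has measure at most \<open>1 - measure M (E n)\<close>
  for all these \<open>n\<close>, hence is null. Without a rate of convergence one gets membership
  infinitely often rather than eventually, and this is enough below.\<close>

lemma (in prob_space) AE_frequently_of_measure_tendsto_1:
  assumes E: "\<And>n::nat. E n \<in> sets M" and lim: "(\<lambda>n. measure M (E n)) \<longlonglongrightarrow> 1"
  shows "AE x in M. \<exists>\<^sub>F n in sequentially. x \<in> E n"
proof -
  define B where "B k = (\<Inter>n\<in>{k..}. space M - E n)" for k
  have B: "B k \<in> sets M" for k
    unfolding B_def using E by (intro sets.countable_INT') auto
  have "measure M (B k) \<le> 1 - measure M (E n)" if "n \<ge> k" for k n
  proof -
    have "measure M (B k) \<le> measure M (space M - E n)"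
      by (rule finite_measure_mono) (use E that in \<open>auto simp: B_def\<close>)
    then show ?thesis using E by (simp add: prob_compl)
  qed
  then have "measure M (B k) \<le> 1 - 1" for k
    by (intro LIMSEQ_le_const[OF tendsto_diff[OF tendsto_const lim]]) blast
  then have "emeasure M (B k) = 0" for k
    using measure_le_0_iff[of M "B k"] by (simp add: emeasure_eq_measure)
  then have "B k \<in> null_sets M" for k
    using B by (rule null_setsI)
  then have "AE x in M. \<forall>k. x \<notin> B k"
    unfolding AE_all_countable by (intro allI AE_not_in)
  then show ?thesis
  proof (rule AE_mp, intro AE_I2 impI)
    fix x assume x: "x \<in> space M" "\<forall>k. x \<notin> B k"
    then have "\<exists>n\<ge>k. x \<in> E n" for k
      unfolding B_def by auto
    then show "\<exists>\<^sub>F n in sequentially. x \<in> E n"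
      unfolding frequently_sequentially by simp
  qed
qed

theorem lemmaI:
  fixes G :: "('g, 'c) monoid_scheme"
    and M :: "'x measure"
    and act :: "'g \<Rightarrow> 'x \<Rightarrow> 'x"
    and H :: "('h, 'd) monoid_scheme"
    and T :: "'h topology"
    and w :: "'g \<times> 'x \<Rightarrow> 'h"
    and \<phi> :: "nat \<Rightarrow> 'x \<Rightarrow> 'h"
  assumes "group G" and "countable (carrier G)"
    and "standard_prob_space M"
    and "strongly_ergodic_action G M act"
    and "polish_group H T"
    and "cocycle G M act H T w"
    and "\<And>n. n \<ge> 1 \<Longrightarrow> \<phi> n \<in> M \<rightarrow>\<^sub>M borel_of T"
    and "\<And>g. g \<in> carrier G \<Longrightarrow>
      (\<lambda>n. measure M {x \<in> space M. w (g, x) = \<phi> n (act g x) \<otimes>\<^bsub>H\<^esub> inv\<^bsub>H\<^esub> (\<phi> n x)}) \<longlonglongrightarrow> 1"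
  shows "\<exists>\<psi>. \<psi> \<in> M \<rightarrow>\<^sub>M borel_of T \<and>
    (\<forall>g\<in>carrier G. AE x in M. w (g, x) = \<psi> (act g x) \<otimes>\<^bsub>H\<^esub> inv\<^bsub>H\<^esub> (\<psi> x))"
proof -
  interpret prob_space M
    using assms(3) unfolding standard_prob_space_def by simp
  interpret H: group H by (rule polish_groupD(1)[OF assms(5)])
  note H = assms(5)
  note \<phi> = assms(7)
  note T = polish_groupD(3,4)[OF H] and HT = polish_groupD(2)[OF H]
  have pmp: "pmp_action G M act"
    using assms(4) unfolding strongly_ergodic_action_def ergodic_action_def by simp
  have w: "(\<lambda>x. w (g, x)) \<in> M \<rightarrow>\<^sub>M borel_of T" if "g \<in> carrier G" for g
  proof -
    have "w \<in> count_space (carrier G) \<Otimes>\<^sub>M M \<rightarrow>\<^sub>M borel_of T"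
      using assms(6) unfolding cocycle_def by simp
    then show ?thesis
      by (rule measurable_compose[rotated]) (simp add: that measurable_Pair1')
  qed
  \<comment> \<open>The tolerances \<open>(1 / 2) ^ k\<close> are chosen to be summable for
    Borel-Cantelli.\<close>
  have "\<exists>N. \<forall>m\<ge>N. \<forall>n\<ge>N. \<exists>c\<in>carrier H.
      measure M {x \<in> space M. inv\<^bsub>H\<^esub> (\<phi> m x) \<otimes>\<^bsub>H\<^esub> \<phi> n x = c} \<ge> 1 - (1 / 2) ^ k" for k :: nat
    by (rule coboundary_quotients_almost_constant[OF assms(4,2) prob_space_axioms H w \<phi> assms(8)])
      simp_all
  then obtain N :: "nat \<Rightarrow> nat" where N: "\<forall>m\<ge>N k. \<forall>n\<ge>N k. \<exists>c\<in>carrier H.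
      measure M {x \<in> space M. inv\<^bsub>H\<^esub> (\<phi> m x) \<otimes>\<^bsub>H\<^esub> \<phi> n x = c} \<ge> 1 - (1 / 2) ^ k" for k
    by metis
  \<comment> \<open>The partial sum makes both \<open>r k\<close> and \<open>r (Suc k)\<close> at
    least \<open>N k\<close>, the summand \<open>k\<close> sends \<open>r\<close> to infinity, and
    \<open>Suc\<close> keeps the indices at least 1.\<close>
  define r where "r k = Suc (k + sum N {..k})" for k
  have r_ge: "r k \<ge> 1" "r k \<ge> k" "r k \<ge> N k" "r (Suc k) \<ge> N k" for k
  proof -
    have "N k \<le> sum N {..k}" by (rule member_le_sum) simp_all
    then show "r k \<ge> 1" "r k \<ge> k" "r k \<ge> N k" "r (Suc k) \<ge> N k"
      unfolding r_def by simp_all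
  qed
  define large where "large k d \<longleftrightarrow>
    measure M {x \<in> space M. inv\<^bsub>H\<^esub> (\<phi> (r k) x) \<otimes>\<^bsub>H\<^esub> \<phi> (r (Suc k)) x = d} \<ge> 1 - (1 / 2) ^ k" for k d
  have "\<exists>d\<in>carrier H. large k d" for k
    unfolding large_def by (rule N[rule_format, OF r_ge(3,4)])
  then obtain h where h: "\<And>k. h k \<in> carrier H" and h_large: "\<And>k. large k (h k)"
    by metis
  \<comment> \<open>On a large set \<open>\<phi> (r (Suc k))\<close> is \<open>\<phi> (r k)\<close>
    times \<open>h k\<close>. For the corrected maps at \<open>k\<close> and \<open>Suc k\<close> to
    agree there, the next constant must be the inverse of \<open>h k\<close> times the current
    one.\<close>
  define c where "c = rec_nat \<one>\<^bsub>H\<^esub> (\<lambda>k d. inv\<^bsub>H\<^esub> (h k) \<otimes>\<^bsub>H\<^esub> d)"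
  have c_Suc: "c (Suc k) = inv\<^bsub>H\<^esub> (h k) \<otimes>\<^bsub>H\<^esub> c k" for k
    unfolding c_def by simp
  have c: "c k \<in> carrier H" for k
    by (induction k) (simp_all add: c_Suc h, simp add: c_def)
  define \<psi> where "\<psi> k x = \<phi> (r k) x \<otimes>\<^bsub>H\<^esub> c k" for k x
  have \<phi>r: "\<phi> (r k) \<in> M \<rightarrow>\<^sub>M borel_of T" for k
    by (rule \<phi>[OF r_ge(1)])
  have \<phi>_car: "\<phi> (r k) x \<in> carrier H" if "x \<in> space M" for k x
    using measurable_space[OF \<phi>r that] HT by simp
  have \<psi>: "\<psi> k \<in> M \<rightarrow>\<^sub>M borel_of T" for k
    unfolding \<psi>_def
    by (intro polish_group_measurable_mult[OF H] \<phi>r measurable_const) (simp add: HT c)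
  have eq_sets: "{x \<in> space M. \<psi> (Suc k) x = \<psi> k x} \<in> sets M" for k
    by (rule sets_Collect_eq_borel_of[OF \<psi> \<psi> T])
  define D where "D k = {x \<in> space M. \<psi> (Suc k) x \<noteq> \<psi> k x}" for k
  have D_sets: "D k \<in> sets M" for k
    unfolding D_def by (rule sets.sets_Collect_neg[OF eq_sets])
  have D_small: "measure M (D k) \<le> (1 / 2) ^ k" for k
  proof -
    let ?S = "{x \<in> space M. inv\<^bsub>H\<^esub> (\<phi> (r k) x) \<otimes>\<^bsub>H\<^esub> \<phi> (r (Suc k)) x = h k}"
    have "?S \<subseteq> space M - D k"
    proof
      fix x assume "x \<in> ?S"
      then have x: "x \<in> space M" "inv\<^bsub>H\<^esub> (\<phi> (r k) x) \<otimes>\<^bsub>H\<^esub> \<phi> (r (Suc k)) x = h k"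
        by simp_all
      then have "\<phi> (r (Suc k)) x = \<phi> (r k) x \<otimes>\<^bsub>H\<^esub> h k"
        using H.inv_solve_left'[OF h[of k] \<phi>_car[OF x(1), of k] \<phi>_car[OF x(1), of "Suc k"]]
        by simp
      then have "\<psi> (Suc k) x = (\<phi> (r k) x \<otimes>\<^bsub>H\<^esub> h k) \<otimes>\<^bsub>H\<^esub> (inv\<^bsub>H\<^esub> (h k) \<otimes>\<^bsub>H\<^esub> c k)"
        unfolding \<psi>_def c_Suc by simp
      also have "\<dots> = \<phi> (r k) x \<otimes>\<^bsub>H\<^esub> (h k \<otimes>\<^bsub>H\<^esub> (inv\<^bsub>H\<^esub> (h k) \<otimes>\<^bsub>H\<^esub> c k))"
        by (rule H.m_assoc) (simp_all add: h c \<phi>_car x(1))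
      also have "h k \<otimes>\<^bsub>H\<^esub> (inv\<^bsub>H\<^esub> (h k) \<otimes>\<^bsub>H\<^esub> c k) = c k"
        using H.m_assoc[of "h k" "inv\<^bsub>H\<^esub> (h k)" "c k"] h[of k] c[of k] by simp
      also have "\<phi> (r k) x \<otimes>\<^bsub>H\<^esub> c k = \<psi> k x"
        unfolding \<psi>_def ..
      finally show "x \<in> space M - D k"
        unfolding D_def using x(1) by simp
    qed
    then have "measure M ?S \<le> measure M (space M - D k)"
      by (rule finite_measure_mono) (rule sets.compl_sets[OF D_sets])
    then show ?thesis
      using h_large[of k, unfolded large_def] prob_compl[OF D_sets[of k]] by linarith
  qed
  have "summable (\<lambda>k. measure M (D k))"
    by (rule summable_comparison_test'[OF summable_geometric[of "1 / 2 :: real"], of 0])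
      (simp_all add: D_small)
  then have "AE x in M. \<forall>\<^sub>F k in sequentially. x \<in> space M - D k"
    by (rule borel_cantelli_AE1[OF D_sets, rotated]) (simp add: emeasure_eq_measure)
  then have "AE x in M. \<forall>\<^sub>F k in sequentially. \<psi> (Suc k) x = \<psi> k x"
    by (rule AE_mp) (intro AE_I2 impI, erule eventually_mono, simp add: D_def)
  then obtain \<Psi> where \<Psi>: "\<Psi> \<in> M \<rightarrow>\<^sub>M borel_of T"
    and lim: "AE x in M. \<forall>\<^sub>F k in sequentially. \<psi> k x = \<Psi> x"
    by (rule measurable_eventually_constant_limit[where f = \<psi>, OF \<psi> eq_sets])
  have "AE x in M. w (g, x) = \<Psi> (act g x) \<otimes>\<^bsub>H\<^esub> inv\<^bsub>H\<^esub> (\<Psi> x)" if g: "g \<in> carrier G" for g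
  proof -
    have act: "act g \<in> M \<rightarrow>\<^sub>M M"
      and inv: "\<And>A. A \<in> sets M \<Longrightarrow> emeasure M (act g -` A \<inter> space M) = emeasure M A"
      using pmp g unfolding pmp_action_def by simp_all
    \<comment> \<open>Invariance of the measure as an equality of measures, so that the almost
      everywhere limit at \<open>x\<close> can be transported to the point
      \<open>act g x\<close>.\<close>
    have distr: "distr M M (act g) = M"
      by (rule measure_eqI) (simp_all add: emeasure_distr act inv)
    have lim_act: "AE x in M. \<forall>\<^sub>F k in sequentially. \<psi> k (act g x) = \<Psi> (act g x)"
      by (rule AE_distrD[OF act]) (unfold distr, rule lim)
    define E where
      "E n = {x \<in> space M. w (g, x) = \<phi> n (act g x) \<otimes>\<^bsub>H\<^esub> inv\<^bsub>H\<^esub> (\<phi> n x)}" for n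
    have "(\<lambda>n. measure M (E n)) \<longlonglongrightarrow> 1"
      unfolding E_def by (rule assms(8)[OF g])
    moreover have "filterlim r sequentially sequentially"
      by (rule filterlim_at_top_mono[OF filterlim_ident]) (simp add: r_ge)
    ultimately have "(\<lambda>k. measure M (E (r k))) \<longlonglongrightarrow> 1"
      by (rule filterlim_compose)
    moreover have "E (r k) \<in> sets M" for k
      unfolding E_def by (rule sets_Collect_coboundary[OF H act w[OF g] \<phi>r])
    ultimately have "AE x in M. \<exists>\<^sub>F k in sequentially. x \<in> E (r k)"
      by (intro AE_frequently_of_measure_tendsto_1)
    \<comment> \<open>At almost every \<open>x\<close> the corrected maps have eventually reached
      their limits at both \<open>x\<close> and \<open>act g x\<close>, while the coboundary
      equation holds for infinitely many \<open>k\<close>. A single \<open>k\<close> with all three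
      properties gives the identity, since \<open>c k\<close> cancels.\<close>
    with lim lim_act show ?thesis
    proof eventually_elim
      case (elim x)
      then have "\<exists>\<^sub>F k in sequentially. (x \<in> E (r k) \<and> \<psi> k x = \<Psi> x) \<and> \<psi> k (act g x) = \<Psi> (act g x)"
        by (intro frequently_eventually_frequently)
      then obtain k where k: "x \<in> E (r k)" "\<psi> k x = \<Psi> x" "\<psi> k (act g x) = \<Psi> (act g x)"
        by (auto dest: frequently_ex)
      then have x: "x \<in> space M" unfolding E_def by simp
      have gx: "act g x \<in> space M" by (rule measurable_space[OF act x])
      have "w (g, x) = \<phi> (r k) (act g x) \<otimes>\<^bsub>H\<^esub> inv\<^bsub>H\<^esub> (\<phi> (r k) x)"
        using k(1) unfolding E_def by simp
      also have "\<dots> = \<psi> k (act g x) \<otimes>\<^bsub>H\<^esub> inv\<^bsub>H\<^esub> (\<psi> k x)"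
        unfolding \<psi>_def
        by (rule H.mult_right_cancel_in_quotient[symmetric]) (simp_all add: \<phi>_car x gx c)
      finally show ?case
        unfolding k .
    qed
  qed
  with \<Psi> show ?thesis
    by (intro exI[of _ \<Psi>] conjI ballI)
qed

end
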